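(* Let $\Pi$ be a projective plane of order $q\ge 6$. Then $I(\Pi)$ admits no monomial rank-$\le 3$ lift. Equivalently, if $\mathrm{Kapr}(I(\Pi))\le 3$, then every rank-$\le 3$ lift $F(t)=U+tV+O(t^2)$ of $I(\Pi)$ must contain some valuation-$0$ entry with a nontrivial first-order correction, i.e. there is a point $p$ and a line $\ell$ with $p\notin \ell$ and $V_{p\ell}\neq 0$.
   Context: A projective plane $\Pi$ of order $q$ has a finite point set $P$ and line set $L$ with $|P|=|L|=q^2+q+1$; any two distinct points lie on a unique line, any two distinct lines meet in a unique point, there exist four points no three collinear, and each line contains $q+1$ points (each point lies on $q+1$ lines). Its incidence matrix $I(\Pi)\in\{0,1\}^{P\times L}$ has $I(\Pi)_{p\ell}=1$ iff $p\in\ell$. $K$ is a discretely valued field with valuation $\mathrm{val}$, uniformizer $t$ with $\mathrm{val}(t)=1$, and residue field $k$ identified with a coefficient subfield of the valuation ring (e.g. $K=k((t))$). A lift of $I(\Pi)$ is a matrix $F\in K^{P\times L}$ with $\mathrm{val}(F_{p\ell})=I(\Pi)_{p\ell}$ entrywise; it is a rank-$\le 3$ lift if its rank over $K$ is at most $3$. $\mathrm{Kapr}(I(\Pi))$ is the minimum rank of a lift. Every lift has an entrywise expansion $F=U+tV+O(t^2)$ with $U,V\in k^{P\times L}$, where $O(t^2)$ denotes a matrix with entries of valuation at least $2$. A rank-$\le 3$ lift of $I(\Pi)$ is monomial if it has the form $F_{p\ell}=t\,a_{p\ell}$ for $p\in\ell$ and $F_{p\ell}=u_{p\ell}$ for $p\notin\ell$,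 with all $a_{p\ell},u_{p\ell}\in k^*$; equivalently $F=U+tA$ where $U_{p\ell}=0$ exactly on incidences and $A_{p\ell}=0$ exactly on nonincidences. *)

theory Defs
  imports "HOL-Analysis.Analysis" "HOL-Library.Extended"
begin

text \<open>
  Points and lines are the elements of two finite types, so that matrices indexed by points (rows)
  and lines (columns) are elements of \<open>'a ^ 'l ^ 'p\<close>; \<open>inc p l\<close> means that \<open>p\<close> lies on \<open>l\<close>.
  The cardinality conditions are partly redundant, but together they fix the order \<open>q\<close>.
\<close>

locale projective_plane =
  fixes inc :: "'p::finite \<Rightarrow> 'l::finite \<Rightarrow> bool" and q :: nat
  assumes card_points: "CARD('p) = q\<^sup>2 + q + 1"
    and card_lines: "CARD('l) = q\<^sup>2 + q + 1"
    and unique_line: "p \<noteq> p' \<Longrightarrow> \<exists>!l. inc p l \<and> inc p' l"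
    and unique_point: "l \<noteq> l' \<Longrightarrow> \<exists>!p. inc p l \<and> inc p l'"
    and quadrangle: "\<exists>Q. card Q = 4 \<and> (\<forall>l. card {p \<in> Q. inc p l} \<le> 2)"
    and card_points_on_line: "card {p. inc p l} = q + 1"
    and card_lines_through_point: "card {l. inc p l} = q + 1"

definition incidence_matrix :: "('p::finite \<Rightarrow> 'l::finite \<Rightarrow> bool) \<Rightarrow> int ^ 'l ^ 'p" where
  "incidence_matrix inc = (\<chi> p l. if inc p l then 1 else 0)"

text \<open>
  A normalized discrete valuation; in \<open>int extended\<close>, \<open>Pinf\<close> is the value of \<open>0\<close>, and \<open>Minf\<close>
  is never taken.
\<close>

locale discretely_valued_field =
  fixes val :: "'a::field \<Rightarrow> int extended" and t :: 'a
  assumes val_not_Minf: "val x \<noteq> Minf"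
    and val_eq_Pinf_iff: "val x = Pinf \<longleftrightarrow> x = 0"
    and val_mult: "val (x * y) = val x + val y"
    and val_add: "min (val x) (val y) \<le> val (x + y)"
    and val_uniformizer: "val t = 1"

text \<open>
  \<open>k\<close> is a coefficient field: a subfield of the valuation ring which the reduction map sends
  bijectively onto the residue field, i.e. every residue class has exactly one representative
  in \<open>k\<close>.
\<close>

locale coefficient_field = discretely_valued_field val t
  for val :: "'a::field \<Rightarrow> int extended" and t :: 'a +
  fixes k :: "'a set"
  assumes zero_in: "0 \<in> k" and one_in: "1 \<in> k"
    and add_in: "x \<in> k \<Longrightarrow> y \<in> k \<Longrightarrow> x + y \<in> k"
    and uminus_in: "x \<in> k \<Longrightarrow> - x \<in> k"
    and mult_in: "x \<in> k \<Longrightarrow> y \<in> k \<Longrightarrow> x * y \<in> k"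
    and inverse_in: "x \<in> k \<Longrightarrow> x \<noteq> 0 \<Longrightarrow> inverse x \<in> k"
    and integral: "x \<in> k \<Longrightarrow> 0 \<le> val x"
    and residue_representative: "0 \<le> val x \<Longrightarrow> \<exists>!c. c \<in> k \<and> 0 < val (x - c)"

definition is_lift ::
  "('a::field \<Rightarrow> int extended) \<Rightarrow> int ^ 'l::finite ^ 'p::finite \<Rightarrow> 'a ^ 'l ^ 'p \<Rightarrow> bool" where
  "is_lift val M F \<longleftrightarrow> (\<forall>p l. val (F $ p $ l) = Fin (M $ p $ l))"

definition Kapr ::
  "('a::field \<Rightarrow> int extended) \<Rightarrow> int ^ 'l::finite ^ 'p::finite \<Rightarrow> nat" where
  "Kapr val M = (LEAST r. \<exists>F :: 'a ^ 'l ^ 'p. is_lift val M F \<and> rank F = r)"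

text \<open>\<open>F = U + t V + O(t\<^sup>2)\<close> with the entries of \<open>U\<close> and \<open>V\<close> in \<open>k\<close>.\<close>

definition first_order_expansion ::
  "('a::field \<Rightarrow> int extended) \<Rightarrow> 'a \<Rightarrow> 'a set \<Rightarrow>
   'a ^ 'l::finite ^ 'p::finite \<Rightarrow> 'a ^ 'l ^ 'p \<Rightarrow> 'a ^ 'l ^ 'p \<Rightarrow> bool" where
  "first_order_expansion val t k F U V \<longleftrightarrow>
     (\<forall>p l. U $ p $ l \<in> k \<and> V $ p $ l \<in> k \<and>
            2 \<le> val (F $ p $ l - (U $ p $ l + t * V $ p $ l)))"

definition is_monomial ::
  "'a::field \<Rightarrow> 'a set \<Rightarrow> ('p::finite \<Rightarrow> 'l::finite \<Rightarrow> bool) \<Rightarrow> 'a ^ 'l ^ 'p \<Rightarrow> bool" where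
  "is_monomial t k inc F \<longleftrightarrow>
     (\<forall>p l. (inc p l \<longrightarrow> (\<exists>a \<in> k - {0}. F $ p $ l = t * a)) \<and>
            (\<not> inc p l \<longrightarrow> F $ p $ l \<in> k - {0}))"

context discretely_valued_field
begin

lemma val_one: "val 1 = 0"
  using val_mult[of 1 1] val_not_Minf[of 1] val_eq_Pinf_iff[of 1]
  by (cases "val 1") (auto simp: zero_extended_def)

lemma uniformizer_nonzero: "t \<noteq> 0"
  using val_uniformizer val_eq_Pinf_iff[of t] by (auto simp: one_extended_def)

lemma lift_exists: "\<exists>F. is_lift val (incidence_matrix inc) F"
  by (rule exI[of _ "\<chi> p l. if inc p l then t else 1"])
     (auto simp: is_lift_def incidence_matrix_def val_one val_uniformizer
        zero_extended_def one_extended_def)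

lemma Kapr_incidence_le_iff:
  fixes inc :: "'p::finite \<Rightarrow> 'l::finite \<Rightarrow> bool"
  shows "Kapr val (incidence_matrix inc) \<le> r \<longleftrightarrow>
    (\<exists>F. is_lift val (incidence_matrix inc) F \<and> rank F \<le> r)"
    (is "?L \<longleftrightarrow> ?R")
proof
  let ?P = "\<lambda>r. \<exists>F. is_lift val (incidence_matrix inc) F \<and> rank F = r"
  obtain F where "is_lift val (incidence_matrix inc) F"
    using lift_exists by blast
  then have "?P (Kapr val (incidence_matrix inc))"
    unfolding Kapr_def by (intro LeastI[of ?P "rank F"]) blast
  then show "?L \<Longrightarrow> ?R" by auto
next
  assume ?R
  then obtain F where F: "is_lift val (incidence_matrix inc) F" "rank F \<le> r" by blast
  have "Kapr val (incidence_matrix inc) \<le> rank F"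
    unfolding Kapr_def using F(1) by (intro Least_le) blast
  with F(2) show ?L by simp
qed

end

context coefficient_field
begin

lemma integral_expansion:
  assumes x: "0 \<le> val x"
  shows "\<exists>u\<in>k. \<exists>v\<in>k. 2 \<le> val (x - (u + t * v))"
proof -
  obtain u where u: "u \<in> k" "0 < val (x - u)" using residue_representative[OF x] by blast
  define y where "y = (x - u) / t"
  have xy: "x - u = t * y" by (simp add: y_def uniformizer_nonzero)
  have "0 \<le> val y"
    using u(2) val_not_Minf[of y] unfolding xy val_mult val_uniformizer
    by (cases "val y") (auto simp: zero_extended_def one_extended_def)
  then obtain v where v: "v \<in> k" "0 < val (y - v)" using residue_representative by blast
  have eq: "x - (u + t * v) = t * (y - v)" using xy by (simp add: algebra_simps)
  have "2 \<le> val (x - (u + t * v))"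
    using v(2) val_not_Minf[of "y - v"] unfolding eq val_mult val_uniformizer
    by (cases "val (y - v)")
       (auto simp: zero_extended_def one_extended_def simp flip: Fin_numeral)
  with u v show ?thesis by blast
qed

lemma first_order_expansion_exists:
  assumes "is_lift val (incidence_matrix inc) F"
  shows "\<exists>U V. first_order_expansion val t k F U V"
proof -
  have "\<forall>p l. 0 \<le> val (F $ p $ l)"
    using assms by (auto simp: is_lift_def incidence_matrix_def zero_extended_def)
  then have "\<forall>p l. \<exists>u v. u \<in> k \<and> v \<in> k \<and> 2 \<le> val (F $ p $ l - (u + t * v))"
    using integral_expansion by blast
  then obtain u v where
    "\<forall>p l. u p l \<in> k \<and> v p l \<in> k \<and> 2 \<le> val (F $ p $ l - (u p l + t * v p l))"
    by metis
  then have "first_order_expansion val t k F (\<chi> p l. u p l) (\<chi> p l. v p l)"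
    by (simp add: first_order_expansion_def)
  then show ?thesis by blast
qed

end

end

theory Submission
  imports Defs
begin

text \<open>
  Suppose \<open>V\<close> vanishes off the incidences; then its entries are nonzero exactly on the incidences.
  On a triangle, the submatrix of \<open>F\<close> formed by its vertices and opposite sides has units on the
  diagonal and non-units elsewhere, so the three vertex rows span the row space of \<open>F\<close> with
  integral coefficients. Comparing the first-order terms of these linear combinations puts all
  rows of \<open>V\<close> into the span of six vectors, namely the vertex rows of \<open>U\<close> and of \<open>V\<close>. But the
  \<open>q + 1 \<ge> 7\<close> points of a line, together with a further line through each of them, give a
  diagonal submatrix of \<open>V\<close> without zeros on the diagonal.
\<close>

section \<open>Linear independence\<close>

text \<open>\<open>vec.independent\<close> concerns sets, where repeated vectors collapse.
  Injectivity is therefore derived alongside it, so that relations and cardinalities can be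
  transferred to the index set.\<close>

lemma independent_image_if_scalars_zero:
  fixes v :: "'i \<Rightarrow> 'a::field ^ 'n"
  assumes S: "finite S"
    and zero: "\<And>c i. (\<Sum>i\<in>S. c i *s v i) = 0 \<Longrightarrow> i \<in> S \<Longrightarrow> c i = 0"
  shows "inj_on v S" and "vec.independent (v ` S)"
proof -
  show inj: "inj_on v S"
  proof (rule inj_onI, rule ccontr)
    fix i j assume ij: "i \<in> S" "j \<in> S" "v i = v j" "i \<noteq> j"
    \<comment> \<open>A repeated vector would give a nontrivial relation with coefficients 1 and
      -1.\<close>
    define c where "c = (\<lambda>m. if m = i then 1 else if m = j then -1 else (0::'a))"
    have "(\<Sum>m\<in>S. c m *s v m) = (\<Sum>m\<in>{i, j}. c m *s v m)"
      using S ij by (intro sum.mono_neutral_right) (auto simp: c_def)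
    also have "\<dots> = 0"
      using ij by (simp add: c_def)
    finally have "c i = 0"
      using ij by (intro zero)
    then show False
      by (simp add: c_def)
  qed
  show "vec.independent (v ` S)"
  proof (rule vec.independent_if_scalars_zero)
    fix f x assume f: "(\<Sum>x\<in>v ` S. f x *s x) = 0" and "x \<in> v ` S"
    then obtain i where i: "i \<in> S" "x = v i" by blast
    have "(\<Sum>i\<in>S. f (v i) *s v i) = 0"
      using f by (simp add: sum.reindex[OF inj])
    from zero[OF this i(1)] show "f x = 0"
      by (simp add: i)
  qed (use S in simp)
qed

text \<open>Read in column \<open>f i\<close>, a linear relation among the rows in \<open>S\<close>
  retains only the term of row \<open>i\<close>, so these rows are independent.\<close>

lemma card_le_dim_rows_if_diagonal:
  fixes V :: "'a::field ^ 'l ^ 'p"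
  assumes diag: "\<And>i. i \<in> S \<Longrightarrow> V $ i $ f i \<noteq> 0"
    and off: "\<And>i j. i \<in> S \<Longrightarrow> j \<in> S \<Longrightarrow> i \<noteq> j \<Longrightarrow> V $ j $ f i = 0"
  shows "card S \<le> vec.dim (rows V)"
proof -
  have zero: "c i = 0" if c: "(\<Sum>j\<in>S. c j *s row j V) = 0" and i: "i \<in> S" for c i
  proof -
    have "(\<Sum>j\<in>S. c j * V $ j $ f i) = (\<Sum>j\<in>S. c j *s row j V) $ f i"
      by (simp add: row_def)
    also have "\<dots> = 0"
      by (simp add: c)
    also have "(\<Sum>j\<in>S. c j * V $ j $ f i) = (\<Sum>j\<in>{i}. c j * V $ j $ f i)"
      using i off by (intro sum.mono_neutral_right) auto
    finally show ?thesis
      using diag[OF i] by simp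
  qed
  have inj: "inj_on (\<lambda>i. row i V) S" and indep: "vec.independent ((\<lambda>i. row i V) ` S)"
    by (rule independent_image_if_scalars_zero; use zero in simp)+
  have "card S = card ((\<lambda>i. row i V) ` S)"
    using inj by (rule card_image[symmetric])
  also have "\<dots> \<le> vec.dim (rows V)"
    by (rule vec.independent_card_le_dim[OF _ indep]) (auto simp: rows_def)
  finally show ?thesis .
qed

section \<open>Projective planes\<close>

context projective_plane
begin

lemma points_eq_if_on_two_lines:
  "inc p l \<Longrightarrow> inc p' l \<Longrightarrow> inc p m \<Longrightarrow> inc p' m \<Longrightarrow> l \<noteq> m \<Longrightarrow> p = p'"
  using unique_point by blast

text \<open>Three points of a quadrangle are not collinear; \<open>f\<close> sends each vertex to
  the opposite side.\<close>

lemma triangle: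
  obtains T :: "'p set" and f :: "'p \<Rightarrow> 'l"
  where "card T = 3" "\<And>i j. i \<in> T \<Longrightarrow> j \<in> T \<Longrightarrow> inc i (f j) \<longleftrightarrow> i \<noteq> j"
proof -
  obtain Q :: "'p set" where Q: "card Q = 4" "\<And>l. card {p \<in> Q. inc p l} \<le> 2"
    using quadrangle by blast
  obtain T where T: "T \<subseteq> Q" "card T = 3"
    using obtain_subset_with_card_n[of 3 Q] Q(1) by auto
  obtain a b c where abc: "T = {a, b, c}" "a \<noteq> b" "a \<noteq> c" "b \<noteq> c"
    using T(2) by (auto simp: card_3_iff)
  have nc: "\<not> (inc a l \<and> inc b l \<and> inc c l)" for l
  proof
    assume "inc a l \<and> inc b l \<and> inc c l"
    then have "card T \<le> card {p \<in> Q. inc p l}"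
      using T(1) abc by (intro card_mono) auto
    with Q(2)[of l] T(2) show False by simp
  qed
  obtain la lb lc where l: "inc b la" "inc c la" "inc a lb" "inc c lb" "inc a lc" "inc b lc"
    using unique_line[OF abc(2)] unique_line[OF abc(3)] unique_line[OF abc(4)] by blast
  have not_inc: "\<not> inc a la" "\<not> inc b lb" "\<not> inc c lc"
    using l nc by blast+
  show ?thesis
  proof
    show "inc i ((\<lambda>p. if p = a then la else if p = b then lb else lc) j) \<longleftrightarrow> i \<noteq> j"
      if "i \<in> T" "j \<in> T" for i j
      using that abc(2-4) l not_inc by (auto simp: abc(1))
  qed (fact T(2))
qed

text \<open>\<open>S\<close> consists of the points of one line \<open>l\<close>, and
  \<open>f\<close> picks a second line through each of them; such a line meets \<open>l\<close> only
  there.\<close>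

lemma transversal_lines:
  assumes "q > 0"
  obtains S :: "'p set" and f :: "'p \<Rightarrow> 'l"
  where "card S = q + 1" "\<And>i j. i \<in> S \<Longrightarrow> j \<in> S \<Longrightarrow> inc i (f j) \<longleftrightarrow> i = j"
proof -
  obtain l :: 'l where True by simp
  \<comment> \<open>Every point lies on \<open>q + 1 \<ge> 2\<close> lines, hence on one other than
    \<open>l\<close>.\<close>
  have "\<exists>m. inc p m \<and> m \<noteq> l" for p
  proof (rule ccontr)
    assume "\<nexists>m. inc p m \<and> m \<noteq> l"
    then have "card {m. inc p m} \<le> card {l}"
      by (intro card_mono) auto
    with card_lines_through_point[of p] assms show False by simp
  qed
  then obtain f where f: "\<And>p. inc p (f p)" "\<And>p. f p \<noteq> l" by metis
  show ?thesis
  proof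
    show "card {p. inc p l} = q + 1" by (rule card_points_on_line)
    show "inc i (f j) \<longleftrightarrow> i = j" if "i \<in> {p. inc p l}" "j \<in> {p. inc p l}" for i j
      using that f points_eq_if_on_two_lines[of i l j "f j"] by auto
  qed
qed

end

section \<open>Discrete valuations\<close>

context discretely_valued_field
begin

lemma val_zero [simp]: "val 0 = Pinf"
  by (simp add: val_eq_Pinf_iff)

lemma val_uminus: "val (- x) = val x"
proof -
  have "val (-1) + val (-1) = Fin 0"
    using val_mult[of "-1" "-1"] val_one by (simp add: zero_extended_def)
  then have "val (-1) = 0"
    by (cases "val (-1)") (auto simp: zero_extended_def)
  then show ?thesis
    using val_mult[of "-1" x] by simp
qed

lemma val_ge_add: "n \<le> val x \<Longrightarrow> n \<le> val y \<Longrightarrow> n \<le> val (x + y)"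
  using val_add[of x y] by (meson min.boundedI order_trans)

lemma val_ge_diff: "n \<le> val x \<Longrightarrow> n \<le> val y \<Longrightarrow> n \<le> val (x - y)"
  using val_ge_add[of n x "- y"] by (simp add: val_uminus)

lemma val_ge_sum: "(\<And>i. i \<in> S \<Longrightarrow> n \<le> val (x i)) \<Longrightarrow> n \<le> val (\<Sum>i\<in>S. x i)"
  by (induction S rule: infinite_finite_induct) (auto intro: val_ge_add)

lemma val_ge_mult: "Fin m \<le> val x \<Longrightarrow> Fin n \<le> val y \<Longrightarrow> Fin (m + n) \<le> val (x * y)"
  using val_mult[of x y] by (cases "val x"; cases "val y") auto

lemma val_pos_iff: "0 < val x \<longleftrightarrow> Fin 1 \<le> val x"
  by (cases "val x") (auto simp: zero_extended_def)

lemma val_uniformizer_mult_ge_iff: "Fin (n + 1) \<le> val (t * x) \<longleftrightarrow> Fin n \<le> val x"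
  using val_mult[of t x] by (cases "val x") (auto simp: val_uniformizer one_extended_def)

text \<open>Otherwise \<open>x = (x + y) - y\<close> would have valuation at least 1.\<close>

lemma val_add_eq_zero:
  assumes "val x = Fin 0" "Fin 1 \<le> val y"
  shows "val (x + y) = Fin 0"
proof (rule ccontr)
  assume ne: "val (x + y) \<noteq> Fin 0"
  have "Fin 0 \<le> val (x + y)"
    using assms by (intro val_ge_add) (auto intro: order_trans[of _ "Fin 1"])
  with ne have "Fin 1 \<le> val (x + y)"
    by (cases "val (x + y)") auto
  then have "Fin 1 \<le> val (x + y - y)"
    using assms(2) by (rule val_ge_diff)
  with assms(1) show False by simp
qed

section \<open>Integral coordinates from a matrix with units exactly on the diagonal\<close>

lemma val_le_iff_divide:
  assumes "x \<noteq> 0"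
  shows "val x \<le> val y \<longleftrightarrow> Fin 0 \<le> val (y / x)"
proof -
  have "val y = val x + val (y / x)"
    using val_mult[of x "y / x"] assms by simp
  then show ?thesis
    using assms val_not_Minf[of x] val_eq_Pinf_iff[of x]
    by (cases "val x"; cases "val (y / x)") auto
qed

text \<open>Choose \<open>i\<close> with \<open>c i\<close> of least valuation. In column
  \<open>i\<close> the diagonal term keeps this valuation while the others exceed it, so nothing
  cancels. Hence a vanishing combination has zero coefficients, and an integral one has integral
  coefficients.\<close>

lemma unit_diagonal_val_le:
  assumes T: "finite T" "T \<noteq> {}"
    and diag: "\<And>i. i \<in> T \<Longrightarrow> val (M i i) = Fin 0"
    and off: "\<And>i j. i \<in> T \<Longrightarrow> j \<in> T \<Longrightarrow> i \<noteq> j \<Longrightarrow> Fin 1 \<le> val (M j i)"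
  shows "\<exists>i\<in>T. \<forall>j\<in>T. val (\<Sum>m\<in>T. c m * M m i) \<le> val (c j)"
proof -
  obtain i where i: "i \<in> T" and min: "\<And>j. j \<in> T \<Longrightarrow> val (c i) \<le> val (c j)"
    using T arg_min_if_finite(1)[of T "\<lambda>j. val (c j)"] arg_min_least[of T _ "\<lambda>j. val (c j)"] by metis
  have "val (\<Sum>m\<in>T. c m * M m i) \<le> val (c i)"
  \<comment> \<open>If \<open>c i = 0\<close>, the right-hand side is \<open>Pinf\<close>. Otherwise
    dividing by \<open>c i\<close> leaves integral coefficients and a sum that is a unit plus
    non-units.\<close>
  proof (cases "c i = 0")
    case False
    have split: "(\<Sum>m\<in>T. c m / c i * M m i) = M i i + (\<Sum>m\<in>T - {i}. c m / c i * M m i)"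
      using False T(1) i by (simp add: sum.remove[of T i])
    have "Fin (0 + 1) \<le> val (c m / c i * M m i)" if "m \<in> T - {i}" for m
      using that i min[of m] off[of i m] False
      by (intro val_ge_mult) (auto simp: val_le_iff_divide)
    then have "val (\<Sum>m\<in>T. c m / c i * M m i) = Fin 0"
      unfolding split using diag[OF i] by (intro val_add_eq_zero val_ge_sum) auto
    moreover have "(\<Sum>m\<in>T. c m * M m i) = c i * (\<Sum>m\<in>T. c m / c i * M m i)"
      using False by (simp add: sum_distrib_left)
    ultimately show ?thesis
      using val_mult[of "c i"] by (cases "val (c i)") auto
  qed simp
  with i min show ?thesis
    by (meson order_trans)
qed

text \<open>The domination bound serves twice: it makes the rows in \<open>T\<close> independent,
  hence spanning by the rank bound, and it then makes the coefficients integral.\<close>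

lemma rows_integral_combination:
  fixes F :: "'a ^ 'l::finite ^ 'p::finite"
  assumes rank: "rank F \<le> card T" and T: "T \<noteq> {}"
    and int: "\<And>p l. Fin 0 \<le> val (F $ p $ l)"
    and diag: "\<And>i. i \<in> T \<Longrightarrow> val (F $ i $ f i) = Fin 0"
    and off: "\<And>i j. i \<in> T \<Longrightarrow> j \<in> T \<Longrightarrow> i \<noteq> j \<Longrightarrow> Fin 1 \<le> val (F $ j $ f i)"
  obtains c where "\<And>i. i \<in> T \<Longrightarrow> Fin 0 \<le> val (c i)"
    and "\<And>l. F $ p $ l = (\<Sum>i\<in>T. c i * F $ i $ l)"
proof -
  have dominated: "\<exists>i\<in>T. \<forall>j\<in>T. val (\<Sum>m\<in>T. c m * F $ m $ f i) \<le> val (c j)" for c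
    using unit_diagonal_val_le[of T "\<lambda>m i. F $ m $ f i" c] T diag off by simp
  have zero: "c i = 0" if c: "(\<Sum>j\<in>T. c j *s row j F) = 0" and i: "i \<in> T" for c i
  proof -
    have "(\<Sum>j\<in>T. c j * F $ j $ l) = (\<Sum>j\<in>T. c j *s row j F) $ l" for l
      by (simp add: row_def)
    then show ?thesis
      \<comment> \<open>The zero combination has valuation \<open>Pinf\<close>, which forces every
        coefficient to be 0.\<close>
      using dominated[of c] c i by (auto simp: val_eq_Pinf_iff)
  qed
  have inj: "inj_on (\<lambda>i. row i F) T" and indep: "vec.independent ((\<lambda>i. row i F) ` T)"
    by (rule independent_image_if_scalars_zero; use zero in simp)+
  \<comment> \<open>There are \<open>card T\<close> independent rows in a row space of dimension at
    most \<open>card T\<close>.\<close>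
  have "rows F \<subseteq> vec.span ((\<lambda>i. row i F) ` T)"
    using rank inj indep
    by (intro vec.card_ge_dim_independent) (auto simp: rows_def row_rank_def_gen card_image)
  moreover have "row p F \<in> rows F"
    by (auto simp: rows_def)
  ultimately obtain u where "row p F = (\<Sum>v\<in>(\<lambda>i. row i F) ` T. u v *s v)"
    by (auto simp: vec.span_finite)
  then have row: "row p F = (\<Sum>i\<in>T. u (row i F) *s row i F)"
    by (simp add: sum.reindex[OF inj])
  show ?thesis
  proof
    have "row p F $ l = (\<Sum>i\<in>T. u (row i F) *s row i F) $ l" for l
      using row by (rule arg_cong)
    then show eq: "F $ p $ l = (\<Sum>i\<in>T. u (row i F) * F $ i $ l)" for l
      by (simp add: row_def)
    \<comment> \<open>In a suitable column the integral entry of row \<open>p\<close> has valuation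
      at most that of every coefficient.\<close>
    show "Fin 0 \<le> val (u (row i F))" if "i \<in> T" for i
      using dominated[of "\<lambda>i. u (row i F)"] that int[of p] unfolding eq[symmetric]
      by (meson order_trans)
  qed
qed

end

section \<open>First-order expansions\<close>

context coefficient_field
begin

text \<open>This represents \<open>x\<close> modulo \<open>t * t\<close> by the dual number with
  constant term \<open>u\<close> and first-order term \<open>v\<close>.\<close>

definition expands :: "'a \<Rightarrow> 'a \<Rightarrow> 'a \<Rightarrow> bool" where
  "expands x u v \<longleftrightarrow> u \<in> k \<and> v \<in> k \<and> Fin 2 \<le> val (x - (u + t * v))"

lemma first_order_expansion_iff:
  "first_order_expansion val t k F U V \<longleftrightarrow> (\<forall>p l. expands (F $ p $ l) (U $ p $ l) (V $ p $ l))"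
  by (simp add: first_order_expansion_def expands_def Fin_numeral)

lemma expands_exact: "u \<in> k \<Longrightarrow> v \<in> k \<Longrightarrow> expands (u + t * v) u v"
  by (simp add: expands_def)

lemma expands_exists: "Fin 0 \<le> val x \<Longrightarrow> \<exists>u v. expands x u v"
  using integral_expansion[of x] by (auto simp: expands_def Fin_numeral zero_extended_def)

lemma val_coefficient: "u \<in> k \<Longrightarrow> Fin 0 \<le> val u"
  using integral by (simp add: zero_extended_def)

text \<open>If \<open>u\<close> has positive valuation, both \<open>u\<close> and 0 represent its
  residue class in \<open>k\<close>, so they coincide.\<close>

lemma val_coefficient_pos_iff:
  assumes "u \<in> k"
  shows "Fin 1 \<le> val u \<longleftrightarrow> u = 0"
proof
  assume u: "Fin 1 \<le> val u"
  have "\<exists>!c. c \<in> k \<and> 0 < val (u - c)"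
    using integral assms by (intro residue_representative) simp
  moreover have "u \<in> k \<and> 0 < val (u - u)" "0 \<in> k \<and> 0 < val (u - 0)"
    using assms zero_in u by (simp_all add: val_pos_iff del: val_zero) simp
  ultimately show "u = 0" by blast
qed simp

text \<open>Reduction modulo \<open>t\<close> kills \<open>u\<close>; dividing the remaining
  \<open>t * v\<close> by \<open>t\<close> then kills \<open>v\<close>.\<close>

lemma first_order_zero:
  assumes "u \<in> k" "v \<in> k" "Fin 2 \<le> val (u + t * v)"
  shows "u = 0 \<and> v = 0"
proof -
  have "Fin 1 \<le> val (u + t * v - t * v)"
    using assms val_uniformizer_mult_ge_iff[of 0 v]
    by (intro val_ge_diff) (auto intro: order_trans[of _ "Fin 2"] val_coefficient)
  then have u: "u = 0"
    using assms(1) by (simp add: val_coefficient_pos_iff)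
  then show ?thesis
    using assms val_uniformizer_mult_ge_iff[of 1 v] by (simp add: val_coefficient_pos_iff)
qed

text \<open>The difference of two expansions expands 0. This uniqueness permits the comparison of
  first-order terms.\<close>

lemma expands_unique:
  assumes "expands x u v" "expands x u' v'"
  shows "u = u'" "v = v'"
proof -
  have "Fin 2 \<le> val (x - (u' + t * v') - (x - (u + t * v)))"
    using assms by (auto simp only: expands_def intro: val_ge_diff[of _ "x - (u' + t * v')"])
  also have "x - (u' + t * v') - (x - (u + t * v)) = (u - u') + t * (v - v')"
    by (simp add: algebra_simps)
  finally have "Fin 2 \<le> val ((u - u') + t * (v - v'))" .
  moreover have "u - u' \<in> k" "v - v' \<in> k"
    using assms add_in[OF _ uminus_in] by (fastforce simp: expands_def)+
  ultimately show "u = u'" "v = v'"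
    using first_order_zero by fastforce+
qed

section \<open>Arithmetic of expansions and the rank bound for first-order terms\<close>

lemma expands_add:
  assumes "expands x u v" "expands x' u' v'"
  shows "expands (x + x') (u + u') (v + v')"
proof -
  have eq: "x + x' - (u + u' + t * (v + v')) = (x - (u + t * v)) + (x' - (u' + t * v'))"
    by (simp add: algebra_simps)
  show ?thesis
    using assms unfolding expands_def eq by (auto intro: add_in val_ge_add simp del: add_diff_eq)
qed

lemma expands_sum:
  "(\<And>i. i \<in> S \<Longrightarrow> expands (x i) (u i) (v i)) \<Longrightarrow>
    expands (\<Sum>i\<in>S. x i) (\<Sum>i\<in>S. u i) (\<Sum>i\<in>S. v i)"
  using expands_exact[OF zero_in zero_in]
  by (induction S rule: infinite_finite_induct) (auto intro: expands_add)

text \<open>This is the product rule for dual numbers; integrality of the factors keeps the errors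
  at valuation at least 2.\<close>

lemma expands_mult:
  assumes "expands x u v" "expands x' u' v'"
  shows "expands (x * x') (u * u') (u * v' + v * u')"
proof -
  define y where "y = u + t * v"
  define y' where "y' = u' + t * v'"
  have k: "u \<in> k" "v \<in> k" "u' \<in> k" "v' \<in> k"
    and err: "Fin 2 \<le> val (x - y)" "Fin 2 \<le> val (x' - y')"
    using assms by (auto simp: expands_def y_def y'_def)
  have t: "Fin 1 \<le> val t"
    by (simp add: val_uniformizer one_extended_def)
  have int: "Fin 0 \<le> val (a + t * b)" if "a \<in> k" "b \<in> k" for a b
    using that val_ge_mult[OF t val_coefficient[of b]]
    by (intro val_ge_add) (auto intro: val_coefficient order_trans[of _ "Fin 1"])
  have x: "Fin 0 \<le> val x"
    using val_ge_add[OF order_trans[OF _ err(1)] int[OF k(1,2)]] by (simp add: y_def)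
  \<comment> \<open>Each summand of this error has valuation at least 2: the first two contain the
    error of one factor, the last contains \<open>t * t\<close>.\<close>
  have "x * x' - (u * u' + t * (u * v' + v * u'))
      = x * (x' - y') + (x - y) * y' + t * t * (v * v')"
    by (simp add: y_def y'_def algebra_simps)
  moreover have "Fin (0 + 2) \<le> val (x * (x' - y'))" "Fin (2 + 0) \<le> val ((x - y) * y')"
    "Fin (1 + 1 + 0) \<le> val (t * t * (v * v'))"
    by (intro val_ge_mult x err t int[of u' v', folded y'_def] val_coefficient mult_in k)+
  ultimately show ?thesis
    using k by (auto simp: expands_def intro: add_in mult_in val_ge_add)
qed

text \<open>If an integral coefficient expands as \<open>a i + t * b i\<close>, its product with row
  \<open>i\<close> has first-order part \<open>a i\<close> times the row of \<open>V\<close> plus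
  \<open>b i\<close> times the row of \<open>U\<close>. Each index in \<open>T\<close> thus
  contributes two spanning vectors.\<close>

lemma dim_rows_first_order_le:
  fixes F :: "'a ^ 'l::finite ^ 'p::finite"
  assumes rank: "rank F \<le> card T" and T: "T \<noteq> {}"
    and int: "\<And>p l. Fin 0 \<le> val (F $ p $ l)"
    and diag: "\<And>i. i \<in> T \<Longrightarrow> val (F $ i $ f i) = Fin 0"
    and off: "\<And>i j. i \<in> T \<Longrightarrow> j \<in> T \<Longrightarrow> i \<noteq> j \<Longrightarrow> Fin 1 \<le> val (F $ j $ f i)"
    and expansion: "first_order_expansion val t k F U V"
  shows "vec.dim (rows V) \<le> 2 * card T"
proof -
  define W where "W = (\<lambda>i. row i U) ` T \<union> (\<lambda>i. row i V) ` T"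
  have "row p V \<in> vec.span W" for p
  proof -
    obtain c where c: "\<And>i. i \<in> T \<Longrightarrow> Fin 0 \<le> val (c i)"
      and F: "\<And>l. F $ p $ l = (\<Sum>i\<in>T. c i * F $ i $ l)"
      using rows_integral_combination[OF rank T int diag off] by metis
    have "\<forall>i. \<exists>u v. i \<in> T \<longrightarrow> expands (c i) u v"
      using c expands_exists by blast
    then obtain a b where ab: "\<And>i. i \<in> T \<Longrightarrow> expands (c i) (a i) (b i)"
      by metis
    \<comment> \<open>Both sides are first-order terms of the same entry of
      \<open>F\<close>.\<close>
    have "V $ p $ l = (\<Sum>i\<in>T. a i * V $ i $ l + b i * U $ i $ l)" for l
    proof (rule expands_unique(2))
      show "expands (F $ p $ l) (U $ p $ l) (V $ p $ l)"
        using expansion by (simp add: first_order_expansion_iff)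
      show "expands (F $ p $ l) (\<Sum>i\<in>T. a i * U $ i $ l) (\<Sum>i\<in>T. a i * V $ i $ l + b i * U $ i $ l)"
        unfolding F using expansion
        by (intro expands_sum expands_mult ab) (simp_all add: first_order_expansion_iff)
    qed
    then have "row p V = (\<Sum>i\<in>T. a i *s row i V + b i *s row i U)"
      by (simp add: vec_eq_iff row_def)
    also have "\<dots> \<in> vec.span W"
      by (intro vec.span_sum vec.span_add vec.span_scale vec.span_base) (auto simp: W_def)
    finally show ?thesis .
  qed
  then have "vec.dim (rows V) \<le> card W"
    by (intro vec.dim_le_card) (auto simp: rows_def W_def)
  also have "\<dots> \<le> card T + card T"
    unfolding W_def by (intro order_trans[OF card_Un_le] add_mono card_image_le) auto
  finally show ?thesis by simp
qed

section \<open>Application to lifts of the incidence matrix\<close>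

lemma first_order_nonzero:
  assumes "expands x u v" "val x = Fin 1"
  shows "v \<noteq> 0"
proof
  assume v: "v = 0"
  \<comment> \<open>With \<open>v = 0\<close>, \<open>u\<close> differs from \<open>x\<close> by an
    error of valuation at least 2. So \<open>u\<close> has positive valuation and vanishes, leaving
    \<open>x\<close> itself of valuation at least 2.\<close>
  have "Fin 1 \<le> val (x - (x - u))"
    by (rule val_ge_diff) (use assms v in \<open>auto simp: expands_def intro: order_trans[of _ "Fin 2"]\<close>)
  then have "u = 0"
    using assms(1) by (simp add: val_coefficient_pos_iff expands_def)
  with assms v show False
    by (simp add: expands_def)
qed

lemma nontrivial_first_order_correction:
  fixes F U V :: "'a ^ 'l::finite ^ 'p::finite"
  assumes plane: "projective_plane inc q" and q: "q \<ge> 6"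
    and lift: "is_lift val (incidence_matrix inc) F" and rank: "rank F \<le> 3"
    and expansion: "first_order_expansion val t k F U V"
  shows "\<exists>p l. \<not> inc p l \<and> V $ p $ l \<noteq> 0"
proof (rule ccontr)
  assume "\<not> ?thesis"
  then have V0: "V $ p $ l = 0" if "\<not> inc p l" for p l
    using that by blast
  interpret projective_plane inc q by (fact plane)
  have val_F: "val (F $ p $ l) = Fin (if inc p l then 1 else 0)" for p l
    using lift by (simp add: is_lift_def incidence_matrix_def)
  obtain T :: "'p set" and f where T: "card T = 3"
    and f: "\<And>i j. i \<in> T \<Longrightarrow> j \<in> T \<Longrightarrow> inc i (f j) \<longleftrightarrow> i \<noteq> j"
    using triangle by blast
  \<comment> \<open>A vertex is off its opposite side and on the other two sides, which gives units
    on the diagonal and valuation 1 elsewhere.\<close>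
  have "vec.dim (rows V) \<le> 2 * card T"
    by (rule dim_rows_first_order_le[where f = f, OF _ _ _ _ _ expansion])
       (use rank T f in \<open>auto simp: val_F\<close>)
  moreover obtain S :: "'p set" and g where S: "card S = q + 1"
    and g: "\<And>i j. i \<in> S \<Longrightarrow> j \<in> S \<Longrightarrow> inc i (g j) \<longleftrightarrow> i = j"
    using transversal_lines q by (metis gr0I not_numeral_le_zero)
  \<comment> \<open>The diagonal positions are incidences, where \<open>V\<close> cannot vanish; off
    the diagonal there are no incidences and \<open>V0\<close> applies.\<close>
  have "card S \<le> vec.dim (rows V)"
  proof (rule card_le_dim_rows_if_diagonal)
    show "V $ i $ g i \<noteq> 0" if "i \<in> S" for i
      using that g[of i i] expansion val_F[of i "g i"]
      by (intro first_order_nonzero) (auto simp: first_order_expansion_iff)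
    show "V $ j $ g i = 0" if "i \<in> S" "j \<in> S" "i \<noteq> j" for i j
      using that g by (intro V0) auto
  qed
  \<comment> \<open>The two bounds give \<open>q + 1 \<le> 6\<close>, against
    \<open>q \<ge> 6\<close>.\<close>
  ultimately show False
    using T S q by simp
qed

text \<open>A monomial lift is its own expansion, with zero error, so the result on corrections
  excludes it.\<close>

lemma monomial_expansion:
  assumes "is_monomial t k inc F"
  obtains U V where "first_order_expansion val t k F U V"
    and "\<And>p l. \<not> inc p l \<Longrightarrow> V $ p $ l = 0"
proof
  let ?U = "\<chi> p l. if inc p l then 0 else F $ p $ l"
  let ?V = "\<chi> p l. if inc p l then F $ p $ l / t else 0"
  have "expands (F $ p $ l) (?U $ p $ l) (?V $ p $ l)" for p l
  proof (cases "inc p l")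
    case True
    then obtain a where "a \<in> k" "F $ p $ l = t * a"
      using assms by (auto simp: is_monomial_def)
    then show ?thesis
      using True expands_exact[OF zero_in, of a] by (simp add: uniformizer_nonzero)
  next
    case False
    then show ?thesis
      using assms expands_exact[OF _ zero_in, of "F $ p $ l"] by (simp add: is_monomial_def)
  qed
  then show "first_order_expansion val t k F ?U ?V"
    by (simp add: first_order_expansion_iff)
qed simp

end

theorem theorem5p10:
  fixes val :: "'a::field \<Rightarrow> int extended" and t :: 'a and k :: "'a set"
    and inc :: "'p::finite \<Rightarrow> 'l::finite \<Rightarrow> bool" and q :: nat
  assumes "coefficient_field val t k"
    and "projective_plane inc q"
    and "q \<ge> 6"
  shows "\<not> (\<exists>F :: 'a ^ 'l ^ 'p. is_lift val (incidence_matrix inc) F \<and> rank F \<le> 3 \<and>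
              is_monomial t k inc F)
    \<and> (Kapr val (incidence_matrix inc) \<le> 3 \<longrightarrow>
        (\<forall>F U V :: 'a ^ 'l ^ 'p.
          is_lift val (incidence_matrix inc) F \<and> rank F \<le> 3 \<and>
          first_order_expansion val t k F U V \<longrightarrow>
          (\<exists>p l. \<not> inc p l \<and> V $ p $ l \<noteq> 0)))"
proof -
  interpret coefficient_field val t k by (fact assms(1))
  note correction = nontrivial_first_order_correction[OF assms(2,3)]
  show ?thesis
  proof (intro conjI notI)
    assume "\<exists>F :: 'a ^ 'l ^ 'p. is_lift val (incidence_matrix inc) F \<and> rank F \<le> 3 \<and>
      is_monomial t k inc F"
    then obtain F :: "'a ^ 'l ^ 'p" where F: "is_lift val (incidence_matrix inc) F"
      "rank F \<le> 3" "is_monomial t k inc F" by blast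
    obtain U V where "first_order_expansion val t k F U V"
      and "\<And>p l. \<not> inc p l \<Longrightarrow> V $ p $ l = 0"
      using monomial_expansion[OF F(3)] by blast
    with correction[OF F(1,2)] show False by blast
  qed (use correction in blast)
qed

end
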